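(* Let $0<\epsilon<1$, let $\mathbb{P}$ be a Borel probability measure on $\mathbb{R}^d$, and let $\mathcal{U}\subseteq\mathbb{R}^d$ be nonempty, convex and compact. (a) If $\delta^*(\mathbf{v}\mid\mathcal{U})\ge \mathrm{VaR}_\epsilon^{\mathbb{P}}(\mathbf{v})$ for all $\mathbf{v}\in\mathbb{R}^d$, then $\mathcal{U}$ implies a probabilistic guarantee at level $\epsilon$ for $\mathbb{P}$; that is, for every function $f(\mathbf{u},\mathbf{x})$ that is concave in $\mathbf{u}$ for every $\mathbf{x}$, and for every $\mathbf{x}^*\in\mathbb{R}^k$, $$\text{if } f(\mathbf{u},\mathbf{x}^* )\le 0\ \ \forall \mathbf{u}\in\mathcal{U},\ \text{ then }\ \mathbb{P}\big(f(\tilde{\mathbf{u}},\mathbf{x}^* )\le 0\big)\ge 1-\epsilon .\qquad( * )$$ (b) If there exists $\mathbf{v}\in\mathbb{R}^d$ such that $\delta^*(\mathbf{v}\mid\mathcal{U})<\mathrm{VaR}_\epsilon^{\mathbb{P}}(\mathbf{v})$, then there exist bi-affine functions $f(\mathbf{u},\mathbf{x})$ for which the implication $( * )$ does not hold (i.e. it fails for some $\mathbf{x}^*$).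
   Context: $\tilde{\mathbf{u}}$ denotes a random vector in $\mathbb{R}^d$ with distribution $\mathbb{P}$. Functions $f:\mathbb{R}^d\times\mathbb{R}^k\to\mathbb{R}$ are real-valued. The support function of $\mathcal{U}$ is $\delta^*(\mathbf{v}\mid\mathcal{U})=\sup_{\mathbf{u}\in\mathcal{U}}\mathbf{v}^T\mathbf{u}$. The Value at Risk is $\mathrm{VaR}_\epsilon^{\mathbb{P}}(\mathbf{v})=\inf\{t:\mathbb{P}(\tilde{\mathbf{u}}^T\mathbf{v}\le t)\ge 1-\epsilon\}$. A bi-affine function has the form $f(\mathbf{u},\mathbf{x})=\mathbf{u}^T\mathbf{F}\mathbf{x}+\mathbf{f}_u^T\mathbf{u}+\mathbf{f}_x^T\mathbf{x}+f_0$. *)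

theory Defs
  imports "HOL-Probability.Probability"
begin

(* Real-valued supremum: meaningful for nonempty U on which v is bounded above,
   in particular for nonempty compact U. *)
definition support_fun :: "(real^'d) set \<Rightarrow> real^'d \<Rightarrow> real" where
  "support_fun U v = (SUP u\<in>U. v \<bullet> u)"

(* For a Borel probability measure P and 0 < \<epsilon> < 1 the set below is nonempty and
   bounded below, so the real-valued infimum is the intended one. *)
definition VaR :: "(real^'d) measure \<Rightarrow> real \<Rightarrow> real^'d \<Rightarrow> real" where
  "VaR P \<epsilon> v = Inf {t. measure P {u \<in> space P. u \<bullet> v \<le> t} \<ge> 1 - \<epsilon>}"

definition guarantee_at ::
  "(real^'d) measure \<Rightarrow> real \<Rightarrow> (real^'d) set \<Rightarrow> (real^'d \<Rightarrow> real^'k \<Rightarrow> real) \<Rightarrow> real^'k \<Rightarrow> bool"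
  where
  "guarantee_at P \<epsilon> U f x \<longleftrightarrow>
     ((\<forall>u\<in>U. f u x \<le> 0) \<longrightarrow> measure P {u \<in> space P. f u x \<le> 0} \<ge> 1 - \<epsilon>)"

(* The type argument fixes the space of decision vectors x. *)
definition implies_prob_guarantee ::
  "'k::finite itself \<Rightarrow> (real^'d) measure \<Rightarrow> real \<Rightarrow> (real^'d) set \<Rightarrow> bool" where
  "implies_prob_guarantee _ P \<epsilon> U \<longleftrightarrow>
     (\<forall>f :: real^'d \<Rightarrow> real^'k \<Rightarrow> real.
        (\<forall>x. concave_on UNIV (\<lambda>u. f u x)) \<longrightarrow> (\<forall>x. guarantee_at P \<epsilon> U f x))"

definition bi_affine :: "(real^'d \<Rightarrow> real^'k \<Rightarrow> real) \<Rightarrow> bool" where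
  "bi_affine f \<longleftrightarrow>
     (\<exists>(F :: real^'k^'d) fu fx f0. \<forall>u x. f u x = u \<bullet> (F *v x) + fu \<bullet> u + fx \<bullet> x + f0)"

end

theory Submission
  imports Defs
begin

text \<open>
  For a real-valued concave \<open>g\<close>, the violation region \<open>{u. g u > 0}\<close> is convex and open, because
  finite concave functions on the whole space are continuous. If \<open>g \<le> 0\<close> on the convex
  set \<open>U\<close>, this region is disjoint from \<open>U\<close>, so some hyperplane with normal \<open>v\<close> separates the two;
  pushing the hyperplane back until it touches \<open>U\<close> shows that the whole halfspace
  \<open>{u. v \<bullet> u \<le> support_fun U v}\<close> is free of violations
  (\<open>concave_nonpos_on_support_halfspace\<close>). Thus among all concave constraints the linear ones
  are the critical ones, and their chance constraints are exactly statements about quantiles: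
  \<open>P (v \<bullet> u \<le> t) \<ge> 1 - \<epsilon>\<close> holds if and only if \<open>VaR P \<epsilon> v \<le> t\<close> (\<open>VaR_le_iff\<close>).

  Part (a) reads this equivalence from left to right at \<open>t = support_fun U v\<close>. In part (b) the
  left-hand side fails for this \<open>t\<close>, hence so does the right-hand side: the affine constraint
  \<open>v \<bullet> u - support_fun U v \<le> 0\<close>, which holds throughout \<open>U\<close> by the definition of the support
  function, is satisfied with probability less than \<open>1 - \<epsilon>\<close>.
\<close>

text \<open>
  The generalized inverse of a distribution function: at a level \<open>p > 0\<close> the superlevel set is
  bounded below since \<open>cdf M\<close> tends to \<open>0\<close> at \<open>-\<infinity>\<close>, at a level \<open>p < 1\<close> it is nonempty since
  \<open>cdf M\<close> tends to \<open>1\<close> at \<open>\<infinity>\<close>, and by right-continuity it contains its infimum.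
\<close>

lemma (in real_distribution) Inf_cdf_ge_le_iff:
  assumes "0 < p" and "p < 1"
  shows "Inf {t. p \<le> cdf M t} \<le> t \<longleftrightarrow> p \<le> cdf M t"
proof -
  let ?S = "{t. p \<le> cdf M t}"
  have "eventually (\<lambda>t. cdf M t < p) at_bot"
    using order_tendstoD(2)[OF cdf_lim_at_bot \<open>0 < p\<close>] .
  then obtain a where a: "\<And>t. t \<le> a \<Longrightarrow> cdf M t < p"
    by (auto simp: eventually_at_bot_linorder)
  have bdd: "bdd_below ?S"
    by (rule bdd_belowI[of _ a]) (use a in \<open>simp, meson linear not_le\<close>)
  have "eventually (\<lambda>t. p < cdf M t) at_top"
    using order_tendstoD(1)[OF cdf_lim_at_top_prob \<open>p < 1\<close>] .
  then have ne: "?S \<noteq> {}"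
    by (auto simp: eventually_at_top_linorder intro: less_imp_le)
  have above: "p \<le> cdf M s" if "Inf ?S < s" for s
    using cInf_lessD[OF ne that] cdf_nondecreasing by (auto intro: order.trans less_imp_le)
  have "eventually (\<lambda>s. p \<le> cdf M s) (at_right (Inf ?S))"
    using above by (auto simp: eventually_at_filter)
  moreover have "(cdf M \<longlongrightarrow> cdf M (Inf ?S)) (at_right (Inf ?S))"
    using cdf_is_right_cont[of "Inf ?S"] by (simp add: continuous_within)
  ultimately have attained: "p \<le> cdf M (Inf ?S)"
    by (intro tendsto_lowerbound) auto
  show ?thesis
    using attained cdf_nondecreasing[of "Inf ?S" t] cInf_lower[OF _ bdd, of t] by auto
qed

lemma VaR_le_iff:
  fixes P :: "(real^'d) measure"
  assumes "0 < \<epsilon>" and "\<epsilon> < 1" and "prob_space P" and P: "sets P = sets borel"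
  shows "VaR P \<epsilon> v \<le> t \<longleftrightarrow> 1 - \<epsilon> \<le> measure P {u \<in> space P. u \<bullet> v \<le> t}"
proof -
  interpret P: prob_space P by fact
  have "(\<lambda>u. u \<bullet> v) \<in> borel_measurable borel"
    by simp
  then have meas: "(\<lambda>u. u \<bullet> v) \<in> borel_measurable P"
    by (simp add: measurable_cong_sets[OF P refl])
  interpret D: real_distribution "distr P borel (\<lambda>u. u \<bullet> v)"
    using meas by (rule P.real_distribution_distr)
  have cdf: "cdf (distr P borel (\<lambda>u. u \<bullet> v)) s = measure P {u \<in> space P. u \<bullet> v \<le> s}" for s
    unfolding cdf_def using meas
    by (subst measure_distr) (auto intro!: arg_cong[where f="measure P"])
  show ?thesis
    using D.Inf_cdf_ge_le_iff[of "1 - \<epsilon>" t] assms(1,2) by (simp add: VaR_def cdf)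
qed

lemma inner_le_support_fun:
  assumes "compact U" and "u \<in> U"
  shows "v \<bullet> u \<le> support_fun U v"
proof -
  have "compact ((\<lambda>u. v \<bullet> u) ` U)"
    by (intro compact_continuous_image continuous_intros assms)
  then have "bdd_above ((\<lambda>u. v \<bullet> u) ` U)"
    by (intro bounded_imp_bdd_above compact_imp_bounded)
  then show ?thesis
    unfolding support_fun_def using \<open>u \<in> U\<close> by (rule cSUP_upper2) simp
qed

lemma concave_on_imp_continuous_on_UNIV:
  fixes g :: "'a::euclidean_space \<Rightarrow> real"
  assumes "concave_on UNIV g"
  shows "continuous_on UNIV g"
proof -
  have "continuous_on UNIV (\<lambda>x. - (- g x))"
    using assms by (intro continuous_on_minus convex_on_continuous) (auto simp: concave_on_def)
  then show ?thesis
    by simp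
qed

text \<open>
  The violation region and \<open>U\<close> are separated by a hyperplane \<open>{u. v \<bullet> u = b}\<close>. The violation region
  lies strictly on its side: at a point on the hyperplane, moving a little along \<open>-v\<close> would stay in
  this open set and yet cross the hyperplane. The level \<open>b\<close> may then be lowered to
  \<open>support_fun U v\<close>, because \<open>b\<close> bounds \<open>v \<bullet> u\<close> on \<open>U\<close>. A constraint without any violation is
  covered by \<open>v = 0\<close>.
\<close>

lemma concave_nonpos_on_support_halfspace:
  fixes g :: "real^'d \<Rightarrow> real"
  assumes g: "concave_on UNIV g" and U: "U \<noteq> {}" "convex U"
    and nonpos: "\<And>u. u \<in> U \<Longrightarrow> g u \<le> 0"
  obtains v where "\<And>u. v \<bullet> u \<le> support_fun U v \<Longrightarrow> g u \<le> 0"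
proof (cases "{u. 0 < g u} = {}")
  case True
  then have "g u \<le> 0" for u
    by (simp add: not_less)
  then show thesis
    by (intro that[of 0])
next
  case False
  let ?C = "{u. 0 < g u}"
  have "open ?C"
    by (rule open_Collect_less[OF continuous_on_const concave_on_imp_continuous_on_UNIV[OF g]])
  moreover have "convex ?C"
    unfolding convex_def
  proof (intro ballI allI impI)
    fix x y and s t :: real
    assume "x \<in> ?C" "y \<in> ?C" "0 \<le> s" "0 \<le> t" "s + t = 1"
    then show "s *\<^sub>R x + t *\<^sub>R y \<in> ?C"
      using convex_lower[of UNIV "\<lambda>u. - g u" x y s t] g by (simp add: concave_on_def)
  qed
  moreover have "U \<inter> ?C = {}"
    using nonpos by force
  ultimately obtain v b where v: "v \<noteq> 0" "\<forall>u\<in>U. v \<bullet> u \<le> b" "\<forall>u\<in>?C. b \<le> v \<bullet> u"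
    using separating_hyperplane_sets[OF U(2) _ U(1) False] by blast
  have strict: "b < v \<bullet> u" if "u \<in> ?C" for u
  proof -
    obtain e where e: "0 < e" "cball u e \<subseteq> ?C"
      using \<open>open ?C\<close> \<open>u \<in> ?C\<close> open_contains_cball by blast
    let ?w = "u - (e / norm v) *\<^sub>R v"
    have "?w \<in> ?C"
      using e v(1) by (intro subsetD[OF e(2)]) (simp add: dist_norm)
    then have "b \<le> v \<bullet> ?w"
      using v(3) by blast
    also have "v \<bullet> ?w < v \<bullet> u"
      using e(1) v(1) by (simp add: inner_diff_right)
    finally show ?thesis .
  qed
  have "support_fun U v \<le> b"
    unfolding support_fun_def using U(1) v(2) by (intro cSUP_least) auto
  then have "g u \<le> 0" if "v \<bullet> u \<le> support_fun U v" for u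
    using strict[of u] that by force
  then show thesis
    by (intro that[of v])
qed

theorem theorem1:
  fixes P :: "(real^'d) measure" and U :: "(real^'d) set" and \<epsilon> :: real
  assumes "0 < \<epsilon>" and "\<epsilon> < 1"
    and "prob_space P" and "sets P = sets borel"
    and "U \<noteq> {}" and "convex U" and "compact U"
  shows "((\<forall>v. support_fun U v \<ge> VaR P \<epsilon> v) \<longrightarrow> implies_prob_guarantee TYPE('k::finite) P \<epsilon> U) \<and>
    ((\<exists>v. support_fun U v < VaR P \<epsilon> v) \<longrightarrow>
      (\<exists>f :: real^'d \<Rightarrow> real^'k \<Rightarrow> real. bi_affine f \<and> (\<exists>x. \<not> guarantee_at P \<epsilon> U f x)))"
proof (intro conjI impI)
  interpret prob_space P by fact
  have VaR_iff: "VaR P \<epsilon> v \<le> t \<longleftrightarrow> 1 - \<epsilon> \<le> measure P {u \<in> space P. u \<bullet> v \<le> t}" for v t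
    by (rule VaR_le_iff) fact+
  {
    assume VaR: "\<forall>v. support_fun U v \<ge> VaR P \<epsilon> v"
    show "implies_prob_guarantee TYPE('k) P \<epsilon> U"
      unfolding implies_prob_guarantee_def guarantee_at_def
    proof (intro allI impI)
      fix f :: "real^'d \<Rightarrow> real^'k \<Rightarrow> real" and x
      assume concave: "\<forall>x. concave_on UNIV (\<lambda>u. f u x)" and nonpos: "\<forall>u\<in>U. f u x \<le> 0"
      obtain v where v: "\<And>u. v \<bullet> u \<le> support_fun U v \<Longrightarrow> f u x \<le> 0"
        using concave_nonpos_on_support_halfspace[of "\<lambda>u. f u x" U] concave nonpos
          \<open>U \<noteq> {}\<close> \<open>convex U\<close> by blast
      have "(\<lambda>u. f u x) \<in> borel_measurable borel"
        using concave by (intro borel_measurable_continuous_onI concave_on_imp_continuous_on_UNIV) auto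
      then have [measurable]: "(\<lambda>u. f u x) \<in> borel_measurable P"
        by (simp add: measurable_cong_sets[OF \<open>sets P = sets borel\<close> refl])
      have "1 - \<epsilon> \<le> measure P {u \<in> space P. u \<bullet> v \<le> support_fun U v}"
        using VaR VaR_iff by blast
      also have "\<dots> \<le> measure P {u \<in> space P. f u x \<le> 0}"
        using v by (intro finite_measure_mono) (auto simp: inner_commute)
      finally show "1 - \<epsilon> \<le> measure P {u \<in> space P. f u x \<le> 0}" .
    qed
  next
    assume "\<exists>v. support_fun U v < VaR P \<epsilon> v"
    then obtain v where v: "support_fun U v < VaR P \<epsilon> v" ..
    define f :: "real^'d \<Rightarrow> real^'k \<Rightarrow> real" where "f u x = v \<bullet> u - support_fun U v" for u x
    have "f u x = u \<bullet> (0 *v x) + v \<bullet> u + 0 \<bullet> x + (- support_fun U v)" for u x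
      by (simp add: f_def)
    then have "bi_affine f"
      unfolding bi_affine_def by blast
    moreover have "\<not> guarantee_at P \<epsilon> U f 0"
      using v VaR_iff[of v "support_fun U v"] inner_le_support_fun[OF \<open>compact U\<close>]
      by (auto simp: guarantee_at_def f_def inner_commute)
    ultimately show "\<exists>f :: real^'d \<Rightarrow> real^'k \<Rightarrow> real. bi_affine f \<and> (\<exists>x. \<not> guarantee_at P \<epsilon> U f x)"
      by blast
  }
qed

end
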